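(* Let $w\in\mathbb{R}^p$ and $\rho>0$. Assume $g_f(w)\neq 0$, $g_r(w)\neq 0$, $q(w)\neq 0$, and that there is $M_r>0$ such that $\|\nabla^2L_r(z)\|_{\mathrm{op}}\le M_r$ for all $z\in\Gamma(w)$, where $$\Gamma(w)=\{w+t\,\delta_{\mathrm{std}}(w):t\in[0,1]\}\cup\{w+t\,\delta_{\mathrm{rosu}}(w):t\in[0,1]\}.$$ If $$\cos\theta(w)>\frac{M_r\rho}{\|g_r(w)\|_2},$$ then $$L_r\bigl(w+\delta_{\mathrm{std}}(w)\bigr)>L_r\bigl(w+\delta_{\mathrm{rosu}}(w)\bigr).$$
   Context: $L_f,L_r:\mathbb{R}^p\to\mathbb{R}$ are differentiable functions (forget and retain losses), with gradients $g_f(w)=\nabla L_f(w)$ and $g_r(w)=\nabla L_r(w)$; $L_r$ is twice differentiable at the points where its Hessian $\nabla^2 L_r$ is used. For nonzero $g_f(w),g_r(w)$, the angle $\theta(w)\in[0,\pi]$ is defined by $\cos\theta(w)=\dfrac{g_f(w)^\top g_r(w)}{\|g_f(w)\|_2\|g_r(w)\|_2}$. Put $P_r(w)=\dfrac{g_r(w)g_r(w)^\top}{\|g_r(w)\|_2^2}$, $q(w)=(I-P_r(w))g_f(w)$, and $$\delta_{\mathrm{std}}(w)=\rho\,\frac{g_f(w)}{\|g_f(w)\|_2},\qquad \delta_{\mathrm{rosu}}(w)=\rho\,\frac{q(w)}{\|q(w)\|_2}.$$ *)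

theory Defs
  imports "HOL-Analysis.Analysis"
begin

definition grad :: "(real^'p \<Rightarrow> real) \<Rightarrow> real^'p \<Rightarrow> real^'p"
  where "grad L w = (THE g. GDERIV L w :> g)"

(* Twice differentiable at z: L is differentiable near z, so that grad L is the
   gradient there, and grad L is Frechet differentiable at z. *)
definition twice_differentiable_at :: "(real^'p \<Rightarrow> real) \<Rightarrow> real^'p \<Rightarrow> bool"
  where "twice_differentiable_at L z \<longleftrightarrow>
    (\<forall>\<^sub>F x in nhds z. L differentiable (at x)) \<and> grad L differentiable (at z)"

definition hessian :: "(real^'p \<Rightarrow> real) \<Rightarrow> real^'p \<Rightarrow> real^'p^'p"
  where "hessian L z = jacobian (grad L) (at z)"

definition op_norm :: "real^'p^'p \<Rightarrow> real"
  where "op_norm A = onorm (\<lambda>v. A *v v)"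

(* The angle in [0, pi] between two nonzero vectors; for nonzero vectors the
   argument of arccos lies in [-1, 1] by Cauchy-Schwarz. *)
definition vec_angle :: "real^'p \<Rightarrow> real^'p \<Rightarrow> real"
  where "vec_angle u v = arccos ((u \<bullet> v) / (norm u * norm v))"

definition theta :: "(real^'p \<Rightarrow> real) \<Rightarrow> (real^'p \<Rightarrow> real) \<Rightarrow> real^'p \<Rightarrow> real"
  where "theta Lf Lr w = vec_angle (grad Lf w) (grad Lr w)"

definition retain_proj :: "(real^'p \<Rightarrow> real) \<Rightarrow> real^'p \<Rightarrow> real^'p^'p"
  where "retain_proj Lr w =
    (1 / (norm (grad Lr w))\<^sup>2) *\<^sub>R
      (columnvector (grad Lr w) ** (rowvector (grad Lr w) :: real^'p^1))"

definition q_vec :: "(real^'p \<Rightarrow> real) \<Rightarrow> (real^'p \<Rightarrow> real) \<Rightarrow> real^'p \<Rightarrow> real^'p"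
  where "q_vec Lf Lr w = (mat 1 - retain_proj Lr w) *v grad Lf w"

definition delta_std :: "real \<Rightarrow> (real^'p \<Rightarrow> real) \<Rightarrow> real^'p \<Rightarrow> real^'p"
  where "delta_std \<rho> Lf w = \<rho> *\<^sub>R ((1 / norm (grad Lf w)) *\<^sub>R grad Lf w)"

definition delta_rosu ::
    "real \<Rightarrow> (real^'p \<Rightarrow> real) \<Rightarrow> (real^'p \<Rightarrow> real) \<Rightarrow> real^'p \<Rightarrow> real^'p"
  where "delta_rosu \<rho> Lf Lr w =
    \<rho> *\<^sub>R ((1 / norm (q_vec Lf Lr w)) *\<^sub>R q_vec Lf Lr w)"

definition Gamma_set ::
    "real \<Rightarrow> (real^'p \<Rightarrow> real) \<Rightarrow> (real^'p \<Rightarrow> real) \<Rightarrow> real^'p \<Rightarrow> (real^'p) set"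
  where "Gamma_set \<rho> Lf Lr w =
    {w + t *\<^sub>R delta_std \<rho> Lf w | t. t \<in> {0..1}} \<union>
    {w + t *\<^sub>R delta_rosu \<rho> Lf Lr w | t. t \<in> {0..1}}"

end

theory Submission
  imports Defs
begin

text \<open>Along a segment of length \<open>\<rho>\<close> the Hessian bound makes \<open>L\<^sub>r\<close> deviate from its linearisation at
  \<open>w\<close> by at most \<open>M\<^sub>r \<rho>\<^sup>2 / 2\<close>. The linear term is \<open>\<rho> \<parallel>g\<^sub>r\<parallel> cos \<theta>\<close> for \<open>\<delta>\<^sub>s\<^sub>t\<^sub>d\<close> and vanishes for \<open>\<delta>\<^sub>r\<^sub>o\<^sub>s\<^sub>u\<close>,
  because \<open>q\<close> is orthogonal to \<open>g\<^sub>r\<close>. Hence the two values differ by at least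
  \<open>\<rho> \<parallel>g\<^sub>r\<parallel> cos \<theta> - M\<^sub>r \<rho>\<^sup>2 > 0\<close>.\<close>

text \<open>Since \<open>grad\<close> is a definite description, it can be used only once existence
  and uniqueness of a gradient vector are known. Existence is Riesz representation of the
  derivative; uniqueness follows from uniqueness of the derivative.\<close>

lemma has_derivative_grad:
  fixes L :: "real^'p \<Rightarrow> real"
  assumes "L differentiable (at x)"
  shows "(L has_derivative (\<lambda>h. grad L x \<bullet> h)) (at x)"
proof -
  obtain L' where L': "(L has_derivative L') (at x)"
    using assms unfolding differentiable_def by blast
  \<comment> \<open>The Riesz representative of \<open>L'\<close>, assembled from its values on the
    standard basis.\<close>
  define g where "g = (\<Sum>i\<in>Basis. L' i *\<^sub>R i)"
  interpret bounded_linear L' using L' by (rule has_derivative_bounded_linear)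
  have "L' h = h \<bullet> g" for h
  proof -
    have "L' h = L' (\<Sum>i\<in>Basis. (h \<bullet> i) *\<^sub>R i)" by (simp add: euclidean_representation)
    also have "\<dots> = (\<Sum>i\<in>Basis. (h \<bullet> i) * L' i)" by (simp add: sum scaleR)
    also have "\<dots> = h \<bullet> g" by (simp add: g_def inner_sum_right mult.commute)
    finally show ?thesis .
  qed
  then have "L' = (\<lambda>h. h \<bullet> g)" by blast
  with L' have G: "GDERIV L x :> g" by (simp add: gderiv_def)
  then have "GDERIV L x :> grad L x"
    unfolding grad_def
  proof (rule theI)
    fix g' assume "GDERIV L x :> g'"
    with G have "(\<lambda>h. h \<bullet> g') = (\<lambda>h. h \<bullet> g)"
      unfolding gderiv_def by (rule has_derivative_unique[symmetric])
    then show "g' = g" by (metis vector_eq_ldot)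
  qed
  then show ?thesis by (simp add: gderiv_def inner_commute)
qed

lemma has_derivative_hessian:
  fixes L :: "real^'p \<Rightarrow> real"
  assumes "twice_differentiable_at L z"
  shows "(grad L has_derivative (\<lambda>h. hessian L z *v h)) (at z)"
  using assms by (simp add: twice_differentiable_at_def hessian_def jacobian_works)

lemma norm_matrix_vector_le_op_norm: "norm (A *v x) \<le> op_norm A * norm x"
  unfolding op_norm_def by (rule onorm) (rule matrix_vector_mul_bounded_linear)

text \<open>Taylor's formula of order two with Lagrange remainder, applied to the restriction of
  \<open>L\<close> to the segment from \<open>w\<close> to \<open>w + d\<close>.\<close>

lemma hessian_bound_linearisation_error:
  fixes L :: "real^'p \<Rightarrow> real"
  assumes diff: "\<And>x. L differentiable (at x)"
    and twice: "\<And>t. t \<in> {0..1} \<Longrightarrow> twice_differentiable_at L (w + t *\<^sub>R d)"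
    and bound: "\<And>t. t \<in> {0..1} \<Longrightarrow> op_norm (hessian L (w + t *\<^sub>R d)) \<le> M"
  shows "\<bar>L (w + d) - L w - grad L w \<bullet> d\<bar> \<le> M * (norm d)\<^sup>2 / 2"
proof -
  let ?c = "\<lambda>t::real. w + t *\<^sub>R d"
  \<comment> \<open>\<open>D m\<close> is the m-th derivative of \<open>D 0\<close> along the
    segment for m up to 2; larger indices repeat \<open>D 2\<close> as a dummy value, which an
    expansion of order two never reads.\<close>
  define D :: "nat \<Rightarrow> real \<Rightarrow> real"
    where "D m t = (if m = 0 then L (?c t) else if m = 1 then grad L (?c t) \<bullet> d
      else (hessian L (?c t) *v d) \<bullet> d)" for m t
  have c: "(?c has_derivative (\<lambda>s. s *\<^sub>R d)) (at t)" for t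
    by (auto intro!: derivative_eq_intros)
  have D0: "DERIV (D 0) t :> D 1 t" for t
    using has_derivative_compose[OF c has_derivative_grad[OF diff]]
    by (simp add: D_def[abs_def] has_field_derivative_def mult.commute[of _ "_ \<bullet> _"])
  have D1: "DERIV (D 1) t :> D 2 t" if "t \<in> {0..1}" for t
    using has_derivative_inner_left
      [OF has_derivative_compose[OF c has_derivative_hessian[OF twice[OF that]]], of d]
    by (simp add: D_def[abs_def] has_field_derivative_def matrix_vector_mult_scaleR
        mult.commute[of _ "_ \<bullet> _"])
  have "\<exists>t>0. t < 1 \<and> D 0 1 = (\<Sum>m<2. D m 0 / fact m * 1 ^ m) + D 2 t / fact 2 * 1 ^ 2"
    using D0 D1 by (intro Maclaurin) (auto simp: numeral_2_eq_2 less_Suc_eq)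
  then obtain t where t: "0 < t" "t < 1"
    and eq: "D 0 1 = (\<Sum>m<2. D m 0 / fact m * 1 ^ m) + D 2 t / fact 2 * 1 ^ 2"
    by blast
  have "L (w + d) - L w - grad L w \<bullet> d = ((hessian L (?c t) *v d) \<bullet> d) / 2"
    using eq by (simp add: D_def numeral_2_eq_2)
  moreover have "\<bar>(hessian L (?c t) *v d) \<bullet> d\<bar> \<le> M * (norm d)\<^sup>2"
  proof -
    have "\<bar>(hessian L (?c t) *v d) \<bullet> d\<bar> \<le> norm (hessian L (?c t) *v d) * norm d"
      by (rule Cauchy_Schwarz_ineq2)
    also have "\<dots> \<le> op_norm (hessian L (?c t)) * norm d * norm d"
      by (intro mult_right_mono norm_matrix_vector_le_op_norm) simp
    also have "\<dots> \<le> M * norm d * norm d"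
      using bound[of t] t by (intro mult_right_mono) auto
    finally show ?thesis by (simp add: power2_eq_square)
  qed
  ultimately show ?thesis by linarith
qed

text \<open>The rank-one matrix acts as orthogonal projection onto the line spanned by the retain
  gradient.\<close>

lemma retain_proj_mult_vec:
  "retain_proj Lr w *v x = ((grad Lr w \<bullet> x) / (norm (grad Lr w))\<^sup>2) *\<^sub>R grad Lr w"
  by (simp add: retain_proj_def vec_eq_iff matrix_vector_mult_def matrix_matrix_mult_def
      columnvector_def rowvector_def inner_vec_def sum_divide_distrib sum_distrib_left mult_ac)

lemma grad_orthogonal_q_vec:
  assumes "grad Lr w \<noteq> 0"
  shows "grad Lr w \<bullet> q_vec Lf Lr w = 0"
  using assms by (simp add: q_vec_def matrix_vector_mult_diff_rdistrib retain_proj_mult_vec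
      inner_diff_right power2_norm_eq_inner)

lemma cos_vec_angle: "cos (vec_angle u v) = (u \<bullet> v) / (norm u * norm v)"
proof -
  have "\<bar>(u \<bullet> v) / (norm u * norm v)\<bar> \<le> 1"
    \<comment> \<open>If a vector vanishes, the quotient is 0 by the convention for division by
      zero, so the bound persists.\<close>
    using Cauchy_Schwarz_ineq2[of u v] by (cases "u = 0 \<or> v = 0") (auto simp: divide_le_eq_1)
  then show ?thesis unfolding vec_angle_def by (rule cos_arccos_abs)
qed

theorem corollary1:
  fixes Lf Lr :: "real^'p \<Rightarrow> real"
    and w :: "real^'p"
    and \<rho> Mr :: real
  assumes "\<forall>x. Lf differentiable (at x)"
    and "\<forall>x. Lr differentiable (at x)"
    and "\<rho> > 0"
    and "grad Lf w \<noteq> 0"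
    and "grad Lr w \<noteq> 0"
    and "q_vec Lf Lr w \<noteq> 0"
    and "\<forall>z\<in>Gamma_set \<rho> Lf Lr w. twice_differentiable_at Lr z"
    and "Mr > 0"
    and "\<forall>z\<in>Gamma_set \<rho> Lf Lr w. op_norm (hessian Lr z) \<le> Mr"
    and "cos (theta Lf Lr w) > Mr * \<rho> / norm (grad Lr w)"
  shows "Lr (w + delta_std \<rho> Lf w) > Lr (w + delta_rosu \<rho> Lf Lr w)"
proof -
  let ?s = "delta_std \<rho> Lf w" and ?r = "delta_rosu \<rho> Lf Lr w" and ?g = "grad Lr w"
  have s: "w + t *\<^sub>R ?s \<in> Gamma_set \<rho> Lf Lr w" if "t \<in> {0..1}" for t
    using that unfolding Gamma_set_def by blast
  have r: "w + t *\<^sub>R ?r \<in> Gamma_set \<rho> Lf Lr w" if "t \<in> {0..1}" for t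
    using that unfolding Gamma_set_def by blast
  have norms: "norm ?s = \<rho>" "norm ?r = \<rho>"
    using assms(3,4,6) by (simp_all add: delta_std_def delta_rosu_def)
  have "\<bar>Lr (w + ?s) - Lr w - ?g \<bullet> ?s\<bar> \<le> Mr * \<rho>\<^sup>2 / 2"
    using hessian_bound_linearisation_error[of Lr w ?s Mr] s assms(2,7,9) norms by simp
  moreover have "\<bar>Lr (w + ?r) - Lr w - ?g \<bullet> ?r\<bar> \<le> Mr * \<rho>\<^sup>2 / 2"
    using hessian_bound_linearisation_error[of Lr w ?r Mr] r assms(2,7,9) norms by simp
  moreover have "?g \<bullet> ?r = 0"
    using grad_orthogonal_q_vec[OF assms(5)] by (simp add: delta_rosu_def)
  moreover have "?g \<bullet> ?s > Mr * \<rho>\<^sup>2"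
  proof -
    \<comment> \<open>The factor \<open>norm ?g\<close> cancels the one in the denominator of the
      cosine.\<close>
    have "?g \<bullet> ?s = \<rho> * (norm ?g * cos (theta Lf Lr w))"
      using assms(5) by (simp add: delta_std_def theta_def cos_vec_angle inner_commute)
    moreover have "Mr * \<rho> < norm ?g * cos (theta Lf Lr w)"
      using assms(5,10) by (simp add: field_simps)
    ultimately show ?thesis
      using assms(3) by (simp add: power2_eq_square mult.left_commute)
  qed
  \<comment> \<open>The two errors total at most \<open>Mr * \<rho>\<^sup>2\<close>, strictly less
    than the gap between the linear terms.\<close>
  ultimately show ?thesis by linarith
qed

end
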